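(* Let $G$ be a finite connected graph with $m$ edges, equipped with data $H_{uu}\in\mathbb{R}$ ($u\in V(G)$), $h:D(G)\to[0,\infty)$ and $\gamma:D(G)\to[-\pi/2,\pi/2]$ with $h_{f^{-1}}=h_f$, $\gamma_{f^{-1}}=-\gamma_f$, defining the Hermitian matrix $\mathbf{H}=(H_{uv})$ as in the context. Let $\lambda\in\mathbb{C}$ with $H_{uu}-\lambda-i\Gamma_u\neq 0$ for all $u\in V(G)$, and let $\mathbf{U}(\lambda)$ be the bond scattering matrix of $G$ induced from $\mathbf{H}$. Then, as formal power series in $u$, \[ \det(\mathbf{I}_{2m}-u\,\mathbf{U}(\lambda))=\prod_{[C]}\bigl(1-w_C\,u^{|C|}\bigr), \] where $[C]$ runs over all equivalence classes of prime cycles of $G$, and for a cycle $C=(e_1,\dots,e_n)$, \[ w_C=\sigma^{(t(e_1))}_{e_1e_2}(\lambda)\,\sigma^{(t(e_2))}_{e_2e_3}(\lambda)\cdots\sigma^{(t(e_n))}_{e_ne_1}(\lambda). \]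
   Context: $G=(V(G),E(G))$ is a finite connected graph without loops or multiple edges; $D(G)=\{(u,v),(v,u): uv\in E(G)\}$ is its set of arcs; for an arc $e=(u,v)$, $o(e)=u$, $t(e)=v$, $e^{-1}=(v,u)$. The Hermitian matrix $\mathbf{H}=(H_{uv})_{u,v\in V(G)}$ has real diagonal entries $H_{uu}$, and for $u\neq v$: $H_{uv}=h_f e^{2i\gamma_f}$ if $f=(u,v)\in D(G)$ and $H_{uv}=0$ otherwise. Put $\Gamma_u=\sum_{f\in D(G),\,o(f)=u}h_f$. For a vertex $u$ and arcs $e,f$, define \[ \sigma^{(u)}_{ef}(\lambda)=i\,\delta_{e^{-1},f}-2\,\frac{\sqrt{h_e}\sqrt{h_f}}{H_{uu}-\lambda-i\Gamma_u}\,e^{i(\gamma_f+\gamma_e)}, \] with $\delta$ the Kronecker delta and $i=\sqrt{-1}$. The bond scattering matrix $\mathbf{U}(\lambda)=(U_{ef})_{e,f\in D(G)}$ is the $2m\times 2m$ matrix with $U_{ef}=\sigma^{(t(e))}_{ef}(\lambda)$ if $t(e)=o(f)$ and $U_{ef}=0$ otherwise. A cycle of length $n=|C|$ is a sequence $C=(e_1,\dots,e_n)$ of arcs with $t(e_j)=o(e_{j+1})$ for $1\le j<n$ and $t(e_n)=o(e_1)$ (backtracking allowed). Two cycles are equivalent if one is a cyclic shift of the other. A cycle is prime if it is not of the form $D^r$ ($D$ traversed $r$ times) for a cycle $D$ and $r\ge 2$. *)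

theory Defs
  imports
    "Graph_Theory.Graph_Theory"
    "Jordan_Normal_Form.Determinant"
    "HOL-Computational_Algebra.Formal_Power_Series"
begin

text \<open>
  A finite simple graph is a \<^const>\<open>pair_graph\<close>: a finite loop-free symmetric set of arcs
  \<^term>\<open>parcs G\<close>, which plays the role of $D(G)$. For an arc \<open>e\<close>, $o(e)$, $t(e)$ and $e^{-1}$ are
  \<^term>\<open>fst e\<close>, \<^term>\<open>snd e\<close> and \<^term>\<open>prod.swap e\<close>.
\<close>

definition edge_set :: "'v pair_pre_digraph \<Rightarrow> 'v set set" where
  "edge_set G = {{u, v} | u v. (u, v) \<in> parcs G}"

text \<open>The argument \<open>d\<close> gives the diagonal entries of the Hermitian matrix.\<close>

definition herm_entry ::
  "'v pair_pre_digraph \<Rightarrow> ('v \<Rightarrow> real) \<Rightarrow> ('v \<times> 'v \<Rightarrow> real) \<Rightarrow> ('v \<times> 'v \<Rightarrow> real) \<Rightarrow> 'v \<Rightarrow> 'v \<Rightarrow> complex"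
where
  "herm_entry G d h \<gamma> u v =
    (if u = v then complex_of_real (d u)
     else if (u, v) \<in> parcs G
       then complex_of_real (h (u, v)) * exp (2 * \<i> * complex_of_real (\<gamma> (u, v)))
     else 0)"

definition arc_weight_sum :: "'v pair_pre_digraph \<Rightarrow> ('v \<times> 'v \<Rightarrow> real) \<Rightarrow> 'v \<Rightarrow> real" where
  "arc_weight_sum G h u = (\<Sum>f \<in> {f \<in> parcs G. fst f = u}. h f)"

definition scat ::
  "'v pair_pre_digraph \<Rightarrow> ('v \<Rightarrow> real) \<Rightarrow> ('v \<times> 'v \<Rightarrow> real) \<Rightarrow> ('v \<times> 'v \<Rightarrow> real) \<Rightarrow> complex
    \<Rightarrow> 'v \<Rightarrow> 'v \<times> 'v \<Rightarrow> 'v \<times> 'v \<Rightarrow> complex"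
where
  "scat G d h \<gamma> lam u e f =
    \<i> * (if prod.swap e = f then 1 else 0)
    - 2 * (complex_of_real (sqrt (h e)) * complex_of_real (sqrt (h f))
           / (herm_entry G d h \<gamma> u u - lam - \<i> * complex_of_real (arc_weight_sum G h u)))
      * exp (\<i> * complex_of_real (\<gamma> f + \<gamma> e))"

definition bond_entry ::
  "'v pair_pre_digraph \<Rightarrow> ('v \<Rightarrow> real) \<Rightarrow> ('v \<times> 'v \<Rightarrow> real) \<Rightarrow> ('v \<times> 'v \<Rightarrow> real) \<Rightarrow> complex
    \<Rightarrow> 'v \<times> 'v \<Rightarrow> 'v \<times> 'v \<Rightarrow> complex"
where
  "bond_entry G d h \<gamma> lam e f = (if snd e = fst f then scat G d h \<gamma> lam (snd e) e f else 0)"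

text \<open>
  Rows and columns of the bond scattering matrix are indexed by arcs; \<open>es\<close> is an enumeration
  of \<^term>\<open>parcs G\<close> without repetition, identifying arcs with positions below \<^term>\<open>length es\<close>.
\<close>

definition bond_scattering_mat ::
  "'v pair_pre_digraph \<Rightarrow> ('v \<Rightarrow> real) \<Rightarrow> ('v \<times> 'v \<Rightarrow> real) \<Rightarrow> ('v \<times> 'v \<Rightarrow> real) \<Rightarrow> complex
    \<Rightarrow> ('v \<times> 'v) list \<Rightarrow> complex mat"
where
  "bond_scattering_mat G d h \<gamma> lam es =
    mat (length es) (length es) (\<lambda>(i, j). bond_entry G d h \<gamma> lam (es ! i) (es ! j))"

definition is_cycle :: "'v pair_pre_digraph \<Rightarrow> ('v \<times> 'v) list \<Rightarrow> bool" where
  "is_cycle G C \<longleftrightarrow>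
    C \<noteq> [] \<and> set C \<subseteq> parcs G \<and>
    (\<forall>j. Suc j < length C \<longrightarrow> snd (C ! j) = fst (C ! Suc j)) \<and>
    snd (last C) = fst (hd C)"

definition cycle_equiv :: "'v pair_pre_digraph \<Rightarrow> (('v \<times> 'v) list \<times> ('v \<times> 'v) list) set" where
  "cycle_equiv G = {(C, D). is_cycle G C \<and> is_cycle G D \<and> (\<exists>k. D = rotate k C)}"

definition prime_cycle :: "'v pair_pre_digraph \<Rightarrow> ('v \<times> 'v) list \<Rightarrow> bool" where
  "prime_cycle G C \<longleftrightarrow>
    is_cycle G C \<and> \<not> (\<exists>D r. is_cycle G D \<and> 2 \<le> r \<and> C = concat (replicate r D))"

definition prime_cycle_classes :: "'v pair_pre_digraph \<Rightarrow> ('v \<times> 'v) list set set" where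
  "prime_cycle_classes G = {C. prime_cycle G C} // cycle_equiv G"

definition cycle_weight ::
  "'v pair_pre_digraph \<Rightarrow> ('v \<Rightarrow> real) \<Rightarrow> ('v \<times> 'v \<Rightarrow> real) \<Rightarrow> ('v \<times> 'v \<Rightarrow> real) \<Rightarrow> complex
    \<Rightarrow> ('v \<times> 'v) list \<Rightarrow> complex"
where
  "cycle_weight G d h \<gamma> lam C =
    (\<Prod>j<length C. scat G d h \<gamma> lam (snd (C ! j)) (C ! j) (C ! (Suc j mod length C)))"

text \<open>
  A product over an arbitrary, possibly infinite, index set: the net of finite partial products
  converges. For formal power series the topology is the $X$-adic one, so this is the usual
  coefficientwise stabilisation, in any order of the factors.
\<close>

definition has_product_over :: "('i \<Rightarrow> complex fps) \<Rightarrow> 'i set \<Rightarrow> complex fps \<Rightarrow> bool" where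
  "has_product_over f I P \<longleftrightarrow> (prod f \<longlongrightarrow> P) (finite_subsets_at_top I)"

lemma herm_entry_hermitian:
  assumes "pair_graph G"
    and "\<And>f. f \<in> parcs G \<Longrightarrow> h (prod.swap f) = h f"
    and "\<And>f. f \<in> parcs G \<Longrightarrow> \<gamma> (prod.swap f) = - \<gamma> f"
  shows "herm_entry G d h \<gamma> v u = cnj (herm_entry G d h \<gamma> u v)"
proof -
  interpret pair_graph G by fact
  have "(u, v) \<in> parcs G \<longleftrightarrow> (v, u) \<in> parcs G"
    by (auto intro: arcs_symmetric)
  moreover have "exp (2 * \<i> * complex_of_real x) = cis (2 * x)"
    "exp (- (2 * \<i> * complex_of_real x)) = cis (- (2 * x))" for x
    by (simp_all add: cis_conv_exp mult_ac)
  ultimately show ?thesis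
    using assms(2)[of "(u, v)"] assms(3)[of "(u, v)"] by (simp add: herm_entry_def cis_cnj)
qed

lemma card_parcs_edge_set:
  assumes "pair_graph G"
  shows "card (parcs G) = 2 * card (edge_set G)"
proof -
  interpret pair_graph G by fact
  have fin: "finite (edge_set G)"
  proof -
    have "edge_set G = (\<lambda>(u, v). {u, v}) ` parcs G"
      by (auto simp: edge_set_def)
    then show ?thesis using pair_finite_arcs by simp
  qed
  define S where "S E = {(u, v). {u, v} = E \<and> (u, v) \<in> parcs G}" for E
  have "parcs G = (\<Union>E\<in>edge_set G. S E)"
    by (auto simp: S_def edge_set_def)
  moreover have "card (S E) = 2" if "E \<in> edge_set G" for E
  proof -
    from that obtain u v where uv: "E = {u, v}" "(u, v) \<in> parcs G"
      by (auto simp: edge_set_def)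
    have "(v, u) \<in> parcs G"
      using uv(2) by (rule arcs_symmetric)
    have "u \<noteq> v"
      using pair_no_loops[OF uv(2)] by simp
    have "S E = {(u, v), (v, u)}"
      using uv \<open>(v, u) \<in> parcs G\<close> by (auto simp: S_def doubleton_eq_iff)
    then show ?thesis using \<open>u \<noteq> v\<close> by simp
  qed
  moreover have "finite (S E)" for E
    by (rule finite_subset[OF _ pair_finite_arcs]) (auto simp: S_def)
  moreover have "S E \<inter> S E' = {}" if "E \<noteq> E'" for E E'
    using that by (auto simp: S_def)
  ultimately show ?thesis
    using fin by (simp add: card_UN_disjoint)
qed

end

theory Submission
  imports Defs "Jordan_Normal_Form.Schur_Decomposition"
begin

text \<open>
  Both sides have constant term 1, so it suffices to compare their logarithmic derivatives.
  If $\mu_1, \dots, \mu_{2m}$ are the eigenvalues of $U$, then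
  $\det(I - uU) = \prod_i (1 - \mu_i u)$, and $-u\,\frac{d}{du}\log$ of it has coefficients
  $\sum_i \mu_i^n = \mathrm{tr}\,U^n$, which is the sum of the weights of all cycles of length $n$.
  Every cycle is uniquely a power of a prime cycle, and a prime cycle of length $l$ has exactly $l$
  distinct cyclic shifts, all of the same weight. Hence
  $\mathrm{tr}\,U^n = \sum_{[C],\,|C| \mid n} |C|\, w_C^{n/|C|}$, which is the $n$-th coefficient of
  $-u\,\frac{d}{du}\log\prod_{[C]}(1 - w_C u^{|C|})$. Only the finitely many classes with
  $|C| \le n$ influence the coefficients up to $n$.
\<close>

subsection \<open>Logarithmic derivatives of finite products\<close>

lemma fps_prod_nth0:
  fixes f :: "'i \<Rightarrow> 'a :: comm_semiring_1 fps"
  shows "fps_nth (prod f F) 0 = (\<Prod>i\<in>F. fps_nth (f i) 0)"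
  by (induction F rule: infinite_finite_induct) auto

text \<open>For l > 0 this is the series l * (a X^l + a^2 X^(2l) + ...), that is, minus X times the
  logarithmic derivative of 1 - a X^l. The guard \<open>0 < n\<close> matters because
  \<open>l dvd 0\<close>: the constant term has to be 0.\<close>

definition power_sum_fps :: "complex \<Rightarrow> nat \<Rightarrow> complex fps" where
  "power_sum_fps a l = Abs_fps (\<lambda>n. if 0 < n \<and> l dvd n then of_nat l * a ^ (n div l) else 0)"

text \<open>A geometric series: multiplication by 1 - a X^l cancels everything but the leading term
  l a X^l.\<close>

lemma X_deriv_factor:
  assumes "0 < l"
  shows "fps_X * fps_deriv (1 - fps_const a * fps_X ^ l)
    = - (1 - fps_const a * fps_X ^ l) * power_sum_fps a l"
proof (rule fps_ext)
  fix n
  \<comment> \<open>At n = l the recursion would refer to the constant term, which is 0 rather than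
    l; hence the separate case.\<close>
  have step: "fps_nth (power_sum_fps a l) n = (if n = l then of_nat l * a else a * fps_nth (power_sum_fps a l) (n - l))"
    if "l \<le> n"
  proof -
    obtain k where n: "n = l + k" using \<open>l \<le> n\<close> le_Suc_ex by blast
    show ?thesis using assms
      by (auto simp: power_sum_fps_def n)
  qed
  have small: "fps_nth (power_sum_fps a l) n = 0" if "n < l"
    using that by (auto simp: power_sum_fps_def dest: dvd_imp_le)
  have "fps_nth (fps_const a * fps_X ^ l * power_sum_fps a l) n
      = (if n < l then 0 else a * fps_nth (power_sum_fps a l) (n - l))"
    by (simp add: mult.assoc fps_X_power_mult_nth)
  then have rhs: "fps_nth (- (1 - fps_const a * fps_X ^ l) * power_sum_fps a l) n = (if n = l then - of_nat l * a else 0)"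
    using step small assms by (auto simp: algebra_simps power_sum_fps_def)
  have lhs: "fps_nth (fps_X * fps_deriv (1 - fps_const a * fps_X ^ l)) n = (if n = l then - of_nat l * a else 0)"
    using assms by (cases n) auto
  show "fps_nth (fps_X * fps_deriv (1 - fps_const a * fps_X ^ l)) n
    = fps_nth (- (1 - fps_const a * fps_X ^ l) * power_sum_fps a l) n"
    unfolding lhs rhs ..
qed

text \<open>Logarithmic derivatives turn products into sums. The identity is kept multiplied out, so
  that no logarithm or division of power series occurs.\<close>

lemma X_deriv_prod:
  assumes "finite I" "\<And>i. i \<in> I \<Longrightarrow> 0 < l i"
  shows "fps_X * fps_deriv (\<Prod>i\<in>I. 1 - fps_const (a i) * fps_X ^ l i)
    = - (\<Prod>i\<in>I. 1 - fps_const (a i) * fps_X ^ l i) * (\<Sum>i\<in>I. power_sum_fps (a i) (l i))"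
  using assms
proof (induction I rule: finite_induct)
  case (insert j I)
  let ?P = "\<Prod>i\<in>I. 1 - fps_const (a i) * fps_X ^ l i"
  let ?f = "1 - fps_const (a j) * fps_X ^ l j"
  have "fps_X * fps_deriv (?f * ?P) = (fps_X * fps_deriv ?f) * ?P + ?f * (fps_X * fps_deriv ?P)"
    unfolding fps_deriv_mult by (simp only: algebra_simps)
  also have "\<dots> = - (?f * ?P) * (power_sum_fps (a j) (l j) + (\<Sum>i\<in>I. power_sum_fps (a i) (l i)))"
    using insert.IH insert.prems X_deriv_factor[of "l j" "a j"] by (simp add: ring_distribs)
  finally show ?case using insert.hyps by simp
qed simp

text \<open>Comparing coefficients, n P_n is minus the sum of P_i S_(n-i) over i \<le> n. As S has
  constant term 0, only i < n contributes, so P_0 and S_1, ..., S_n determine P_n. Agreement of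
  \<open>S\<close> and \<open>T\<close> is asked only up to \<open>n\<close>, so that finite partial
  products over classes qualify.\<close>

lemma fps_nth_eq_of_log_deriv_eq:
  fixes P Q S T :: "complex fps"
  assumes "fps_X * fps_deriv P = - P * S" "fps_X * fps_deriv Q = - Q * T"
    and "fps_nth P 0 = fps_nth Q 0" and "\<And>k. k \<le> n \<Longrightarrow> fps_nth S k = fps_nth T k" and "fps_nth S 0 = 0"
  shows "fps_nth P n = fps_nth Q n"
  using assms(4)
proof (induction n rule: less_induct)
  case (less n)
  show ?case
  proof (cases n)
    case 0
    then show ?thesis using assms(3) by simp
  next
    case (Suc k)
    have P: "of_nat n * fps_nth P n = fps_nth (- P * S) n" unfolding assms(1)[symmetric] Suc by simp
    have Q: "of_nat n * fps_nth Q n = fps_nth (- Q * T) n" unfolding assms(2)[symmetric] Suc by simp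
    have "fps_nth (P * S) n = fps_nth (Q * T) n"
      unfolding fps_mult_nth
    proof (rule sum.cong)
      fix i assume i: "i \<in> {0..n}"
      show "fps_nth P i * fps_nth S (n - i) = fps_nth Q i * fps_nth T (n - i)"
      proof (cases "i = n")
        \<comment> \<open>The induction hypothesis does not reach i = n, but this term is 0 on both
          sides: \<open>T\<close> inherits the constant term 0 from \<open>S\<close>.\<close>
        case True
        then show ?thesis using assms(5) less.prems[of 0] by simp
      next
        case False
        then show ?thesis using i less.IH[of i] less.prems by simp
      qed
    qed simp
    with P Q have "of_nat n * fps_nth P n = of_nat n * fps_nth Q n" by simp
    then show ?thesis using Suc by (simp del: of_nat_Suc)
  qed
qed

subsection \<open>Eigenvalues and traces of powers\<close>

lemma trace_mult_commute:
  fixes A B :: "'a :: comm_semiring_0 mat"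
  assumes "A \<in> carrier_mat n n" "B \<in> carrier_mat n n"
  shows "(\<Sum>i<n. (A * B) $$ (i, i)) = (\<Sum>i<n. (B * A) $$ (i, i))"
proof -
  have "(\<Sum>i<n. (A * B) $$ (i, i)) = (\<Sum>i<n. \<Sum>j<n. A $$ (i, j) * B $$ (j, i))"
    using assms by (intro sum.cong) (auto simp: scalar_prod_def atLeast0LessThan)
  also have "\<dots> = (\<Sum>j<n. \<Sum>i<n. B $$ (j, i) * A $$ (i, j))"
    by (subst sum.swap) (simp add: mult.commute)
  also have "\<dots> = (\<Sum>i<n. (B * A) $$ (i, i))"
    using assms by (intro sum.cong) (auto simp: scalar_prod_def atLeast0LessThan)
  finally show ?thesis .
qed

lemma upper_triangular_pow:
  fixes B :: "'a :: comm_semiring_1 mat"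
  assumes B: "B \<in> carrier_mat n n" and ut: "upper_triangular B"
  shows "i < n \<Longrightarrow> j < n \<Longrightarrow> j \<le> i \<Longrightarrow>
    (B ^\<^sub>m k) $$ (i, j) = (if i = j then B $$ (i, i) ^ k else 0)"
proof (induction k arbitrary: i j)
  case (Suc k)
  have "(B ^\<^sub>m Suc k) $$ (i, j) = (\<Sum>l<n. (B ^\<^sub>m k) $$ (i, l) * B $$ (l, j))"
    using B Suc.prems by (simp add: scalar_prod_def atLeast0LessThan)
  also have "\<dots> = (\<Sum>l<n. if l = i then (if i = j then B $$ (i, i) ^ Suc k else 0) else 0)"
  proof (rule sum.cong)
    fix l assume l: "l \<in> {..<n}"
    \<comment> \<open>For l < i the first factor vanishes by induction; for l > i the second one
      does, since j \<le> i < l.\<close>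
    consider "l < i" | "l = i" | "i < l" by linarith
    then show "(B ^\<^sub>m k) $$ (i, l) * B $$ (l, j)
      = (if l = i then (if i = j then B $$ (i, i) ^ Suc k else 0) else 0)"
    proof cases
      case 1
      then show ?thesis using Suc l by simp
    next
      case 2
      then show ?thesis using Suc.IH[of i i] Suc.prems B upper_triangularD[OF ut, of j i]
        by (auto simp: mult.commute)
    next
      case 3
      then show ?thesis using Suc.prems B l upper_triangularD[OF ut, of j l] by auto
    qed
  qed simp
  finally show ?case using Suc.prems by simp
qed (use B in auto)

text \<open>Schur triangularisation: over the complex numbers \<open>A\<close> is similar to an
  upper triangular \<open>B\<close>, and \<open>ev\<close> lists the diagonal of \<open>B\<close>.
  Determinants and traces are invariant under similarity, so both identities are read off this one
  diagonal.\<close>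

lemma eigenvalue_expansion:
  fixes A :: "complex mat"
  assumes A: "A \<in> carrier_mat n n"
  obtains ev where
    "Determinant.det (1\<^sub>m n - fps_X \<cdot>\<^sub>m map_mat fps_const A) = (\<Prod>i<n. 1 - fps_const (ev i) * fps_X)"
    "\<And>k. (\<Sum>i<n. (A ^\<^sub>m k) $$ (i, i)) = (\<Sum>i<n. ev i ^ k)"
proof -
  \<comment> \<open>As a ring homomorphism, \<open>fps_const\<close> carries the similarity of
    \<open>A\<close> and \<open>B\<close> over to matrices of power series.\<close>
  interpret fps_const_hom: comm_ring_hom "fps_const :: complex \<Rightarrow> complex fps"
    by unfold_locales auto
  obtain as where "char_poly A = (\<Prod>a\<leftarrow>as. [:- a, 1:])"
    using char_poly_factorized[OF A] by blast
  from schur_decomposition_exists[OF A this] obtain B where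
    B: "B \<in> carrier_mat n n" and ut: "upper_triangular B" and "similar_mat A B" by blast
  then obtain P Q where sim: "similar_mat_wit A B P Q"
    by (auto simp: similar_mat_def)
  note PQ = similar_mat_witD2[OF A sim]
  have P: "P \<in> carrier_mat n n" and Q: "Q \<in> carrier_mat n n" using PQ by auto
  let ?h = "map_mat (fps_const :: complex \<Rightarrow> _)"
  let ?M = "\<lambda>C. 1\<^sub>m n - fps_X \<cdot>\<^sub>m ?h C"
  have h: "?h A \<in> carrier_mat n n" "?h B \<in> carrier_mat n n" "?h P \<in> carrier_mat n n" "?h Q \<in> carrier_mat n n"
    using A B P Q by auto
  have one: "?h P * ?h Q = 1\<^sub>m n" "?h Q * ?h P = 1\<^sub>m n"
    using PQ P Q by (metis fps_const_hom.mat_hom_mult fps_const_hom.mat_hom_one)+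
  have "?h A = ?h P * ?h B * ?h Q"
    using PQ P B Q by (metis fps_const_hom.mat_hom_mult mult_carrier_mat)
  then have "fps_X \<cdot>\<^sub>m ?h A = ?h P * (fps_X \<cdot>\<^sub>m ?h B) * ?h Q"
    using h by (simp add: mult_smult_distrib mult_smult_assoc_mat[of _ n n])
  \<comment> \<open>Conjugation fixes the identity matrix because P Q = 1, so the same P and Q make
    I - X A similar to I - X B.\<close>
  moreover have "?h P * ?M B * ?h Q = ?h P * ?h Q - ?h P * (fps_X \<cdot>\<^sub>m ?h B) * ?h Q"
  proof -
    have "?h P * ?M B = ?h P - ?h P * (fps_X \<cdot>\<^sub>m ?h B)"
      using h by (subst mult_minus_distrib_mat[of _ n n]) auto
    then show ?thesis
      using h by (simp only:) (rule minus_mult_distrib_mat[of _ n n], auto)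
  qed
  ultimately have "?M A = ?h P * ?M B * ?h Q"
    using one by simp
  then have "similar_mat (?M A) (?M B)"
    unfolding similar_mat_def similar_mat_wit_def Let_def
    using h one by (intro exI[of _ "?h P"] exI[of _ "?h Q"]) auto
  then have "Determinant.det (?M A) = Determinant.det (?M B)"
    by (rule det_similar)
  also have "\<dots> = prod_list (diag_mat (?M B))"
    using B upper_triangularD[OF ut] by (intro det_upper_triangular[of _ n]) auto
  also have "\<dots> = (\<Prod>i<n. 1 - fps_const (B $$ (i, i)) * fps_X)"
    using B by (auto simp: prod_list_diag_prod atLeast0LessThan mult.commute intro!: prod.cong)
  finally have det: "Determinant.det (?M A) = (\<Prod>i<n. 1 - fps_const (B $$ (i, i)) * fps_X)" .
  have "(\<Sum>i<n. (A ^\<^sub>m k) $$ (i, i)) = (\<Sum>i<n. B $$ (i, i) ^ k)" for k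
  proof -
    have Bk: "B ^\<^sub>m k \<in> carrier_mat n n" using B by simp
    have "(\<Sum>i<n. (A ^\<^sub>m k) $$ (i, i)) = (\<Sum>i<n. (P * (B ^\<^sub>m k * Q)) $$ (i, i))"
      unfolding similar_mat_wit_pow_id[OF sim] using P Bk Q by (simp add: assoc_mult_mat[of _ n n _ n _ n])
    \<comment> \<open>Cyclicity of the trace brings \<open>P\<close> behind \<open>Q\<close>, where
      the two cancel.\<close>
    also have "\<dots> = (\<Sum>i<n. (B ^\<^sub>m k * (Q * P)) $$ (i, i))"
      using P Bk Q by (subst trace_mult_commute[of _ n]) (auto simp: assoc_mult_mat[of _ n n _ n _ n])
    also have "\<dots> = (\<Sum>i<n. (B ^\<^sub>m k) $$ (i, i))"
      using PQ Bk by simp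
    also have "\<dots> = (\<Sum>i<n. B $$ (i, i) ^ k)"
      using upper_triangular_pow[OF B ut] by simp
    finally show ?thesis .
  qed
  with det show thesis by (rule that)
qed

subsection \<open>Traces as sums over cyclic words\<close>

definition cyclic_weight :: "('a \<Rightarrow> 'a \<Rightarrow> complex) \<Rightarrow> 'a list \<Rightarrow> complex" where
  "cyclic_weight f xs = (\<Prod>j<length xs. f (xs ! j) (xs ! (Suc j mod length xs)))"

text \<open>\<open>xs\<close> lists only the interior letters, so the walk has one step more than
  \<open>length xs\<close>. Peeling off the first step matches the expansion of a matrix power from
  the left.\<close>

fun walk_weight :: "('a \<Rightarrow> 'a \<Rightarrow> complex) \<Rightarrow> 'a \<Rightarrow> 'a list \<Rightarrow> 'a \<Rightarrow> complex" where
  "walk_weight f a [] b = f a b"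
| "walk_weight f a (x # xs) b = f a x * walk_weight f x xs b"

lemma walk_weight_eq_prod:
  "walk_weight f a xs b = (\<Prod>j<Suc (length xs). f ((a # xs) ! j) ((xs @ [b]) ! j))"
proof (induction xs arbitrary: a)
  case (Cons x xs)
  show ?case
    by (simp add: Cons.IH prod.lessThan_Suc_shift del: prod.lessThan_Suc)
qed simp

text \<open>A cyclic word is a closed walk: the index modulo the length wraps only at the last
  letter, where both readings yield \<open>x\<close>.\<close>

lemma cyclic_weight_Cons: "cyclic_weight f (x # xs) = walk_weight f x xs x"
  unfolding cyclic_weight_def walk_weight_eq_prod length_Cons
proof (rule prod.cong)
  fix j assume j: "j \<in> {..<Suc (length xs)}"
  show "f ((x # xs) ! j) ((x # xs) ! (Suc j mod Suc (length xs)))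
    = f ((x # xs) ! j) ((xs @ [x]) ! j)"
    using j by (cases "j = length xs") (auto simp: nth_append)
qed simp

lemma lists_length_Suc_bij:
  "bij_betw (\<lambda>(x, xs). x # xs) (S \<times> {xs. set xs \<subseteq> S \<and> length xs = n})
    {xs. set xs \<subseteq> S \<and> length xs = Suc n}"
  by (rule bij_betwI[where g = "\<lambda>xs. (hd xs, tl xs)"]) (auto simp: length_Suc_conv)

lemma pow_mat_Suc_left:
  fixes A :: "'a :: semiring_1 mat"
  assumes "A \<in> carrier_mat n n"
  shows "A ^\<^sub>m Suc k = A * A ^\<^sub>m k"
proof (induction k)
  case (Suc k)
  have "A ^\<^sub>m Suc (Suc k) = (A * A ^\<^sub>m k) * A" using Suc by simp
  also have "\<dots> = A * A ^\<^sub>m Suc k"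
    using assms by (simp add: assoc_mult_mat[of _ n n _ n _ n])
  finally show ?case .
qed (use assms in simp)

text \<open>Expansion over intermediate indices. The induction splits off a factor \<open>A\<close>
  on the left, in step with the recursion of \<open>walk_weight\<close>; \<open>n\<close> interior
  letters belong to the exponent \<open>Suc n\<close>.\<close>

lemma mat_pow_eq_walk_sum:
  assumes "distinct es" and A: "A = mat (length es) (length es) (\<lambda>(i, j). f (es ! i) (es ! j))"
    and "i < length es" "j < length es"
  shows "(A ^\<^sub>m Suc n) $$ (i, j)
    = (\<Sum>xs | set xs \<subseteq> set es \<and> length xs = n. walk_weight f (es ! i) xs (es ! j))"
  using \<open>i < length es\<close>
proof (induction n arbitrary: i)
  case 0
  have "{xs. set xs \<subseteq> set es \<and> length xs = 0} = {[]}" by auto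
  moreover have "A ^\<^sub>m Suc 0 = A" unfolding A by simp
  ultimately show ?case using 0 assms by simp
next
  case (Suc n)
  let ?N = "length es"
  have AC: "A \<in> carrier_mat ?N ?N" unfolding A by simp
  have "A ^\<^sub>m Suc (Suc n) = A * A ^\<^sub>m Suc n"
    using AC by (rule pow_mat_Suc_left)
  then have "(A ^\<^sub>m Suc (Suc n)) $$ (i, j) = (\<Sum>k<?N. A $$ (i, k) * (A ^\<^sub>m Suc n) $$ (k, j))"
    using AC Suc.prems assms(4) by (simp add: scalar_prod_def atLeast0LessThan del: pow_mat.simps)
  also have "\<dots> = (\<Sum>k<?N. f (es ! i) (es ! k) *
      (\<Sum>xs | set xs \<subseteq> set es \<and> length xs = n. walk_weight f (es ! k) xs (es ! j)))"
  proof (rule sum.cong)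
    fix k assume "k \<in> {..<?N}"
    then have "A $$ (i, k) = f (es ! i) (es ! k)" and k: "k < ?N" using Suc.prems by (simp_all add: A)
    then show "A $$ (i, k) * (A ^\<^sub>m Suc n) $$ (k, j) = f (es ! i) (es ! k) *
      (\<Sum>xs | set xs \<subseteq> set es \<and> length xs = n. walk_weight f (es ! k) xs (es ! j))"
      unfolding Suc.IH[OF k] by simp
  qed simp
  \<comment> \<open>Since \<open>es\<close> lists every letter exactly once, positions may be
    replaced by letters.\<close>
  also have "\<dots> = (\<Sum>x\<in>set es. f (es ! i) x *
      (\<Sum>xs | set xs \<subseteq> set es \<and> length xs = n. walk_weight f x xs (es ! j)))"
    using bij_betw_nth[OF \<open>distinct es\<close> refl refl] by (rule sum.reindex_bij_betw)
  also have "\<dots> = (\<Sum>(x, xs)\<in>set es \<times> {xs. set xs \<subseteq> set es \<and> length xs = n}.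
      walk_weight f (es ! i) (x # xs) (es ! j))"
    by (simp add: sum_distrib_left sum.cartesian_product)
  also have "\<dots> = (\<Sum>xs | set xs \<subseteq> set es \<and> length xs = Suc n. walk_weight f (es ! i) xs (es ! j))"
    by (subst sum.reindex_bij_betw[OF lists_length_Suc_bij, symmetric])
      (simp add: case_prod_unfold)
  finally show ?case .
qed

text \<open>A diagonal entry sums over closed walks at its letter, and prefixing that letter gives
  the cyclic words. All words occur here; adjacency in the graph enters later through vanishing
  weights.\<close>

lemma trace_pow_eq_cyclic_sum:
  assumes "distinct es" and A: "A = mat (length es) (length es) (\<lambda>(i, j). f (es ! i) (es ! j))"
    and "0 < n"
  shows "(\<Sum>i<length es. (A ^\<^sub>m n) $$ (i, i))
    = (\<Sum>xs | set xs \<subseteq> set es \<and> length xs = n. cyclic_weight f xs)"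
proof -
  obtain k where n: "n = Suc k" using \<open>0 < n\<close> gr0_implies_Suc by blast
  have "(\<Sum>i<length es. (A ^\<^sub>m n) $$ (i, i)) = (\<Sum>i<length es.
      (\<Sum>xs | set xs \<subseteq> set es \<and> length xs = k. walk_weight f (es ! i) xs (es ! i)))"
    unfolding n by (intro sum.cong refl mat_pow_eq_walk_sum[OF assms(1,2)]) auto
  also have "\<dots> = (\<Sum>x\<in>set es.
      (\<Sum>xs | set xs \<subseteq> set es \<and> length xs = k. walk_weight f x xs x))"
    using bij_betw_nth[OF \<open>distinct es\<close> refl refl] by (rule sum.reindex_bij_betw)
  also have "\<dots> = (\<Sum>(x, xs)\<in>set es \<times> {xs. set xs \<subseteq> set es \<and> length xs = k}.
      cyclic_weight f (x # xs))"
    by (simp add: sum.cartesian_product cyclic_weight_Cons)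
  also have "\<dots> = (\<Sum>xs | set xs \<subseteq> set es \<and> length xs = n. cyclic_weight f xs)"
    unfolding n by (subst sum.reindex_bij_betw[OF lists_length_Suc_bij, symmetric])
      (simp add: case_prod_unfold)
  finally show ?thesis .
qed

subsection \<open>Powers and rotations of words\<close>

lemma length_concat_replicate: "length (concat (replicate r xs)) = r * length xs"
  by (induction r) auto

lemma nth_concat_replicate:
  "i < r * length xs \<Longrightarrow> concat (replicate r xs) ! i = xs ! (i mod length xs)"
proof (induction r arbitrary: i)
  case (Suc r)
  then show ?case
    by (cases "i < length xs") (auto simp: nth_append le_mod_geq)
qed simp

lemma eq_concat_replicate_take:
  assumes "0 < g" "g dvd length xs" "\<And>i. i < length xs \<Longrightarrow> xs ! i = xs ! (i mod g)"
  shows "xs = concat (replicate (length xs div g) (take g xs))"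
proof (cases "xs = []")
  case False
  then have g: "g \<le> length xs" using assms(2) by (simp add: dvd_imp_le)
  show ?thesis
  proof (rule nth_equalityI)
    show "length xs = length (concat (replicate (length xs div g) (take g xs)))"
      using g assms(2) by (simp add: length_concat_replicate)
    fix i assume i: "i < length xs"
    have "concat (replicate (length xs div g) (take g xs)) ! i = take g xs ! (i mod g)"
      using g assms(2) i by (subst nth_concat_replicate) auto
    then show "xs ! i = concat (replicate (length xs div g) (take g xs)) ! i"
      using assms(1,3) i by simp
  qed
qed simp

lemma cyclic_weight_rotate: "cyclic_weight f (rotate k xs) = cyclic_weight f xs"
proof (induction k)
  case (Suc k)
  have "cyclic_weight f (rotate1 ys) = cyclic_weight f ys" for ys
  proof (cases "length ys")
    case (Suc m)
    define H where "H j = f (ys ! j) (ys ! (Suc j mod length ys))" for j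
    have ne: "ys \<noteq> []" using Suc by auto
    \<comment> \<open>The factor of the rotated word at j is the factor of \<open>ys\<close> at the
      cyclically next position, so rotation only permutes the factors.\<close>
    have "cyclic_weight f (rotate1 ys) = (\<Prod>j<Suc m. H (Suc j mod Suc m))"
      unfolding cyclic_weight_def length_rotate1 Suc
    proof (rule prod.cong)
      fix j assume "j \<in> {..<Suc m}"
      moreover have "Suc (Suc j mod Suc m) mod Suc m = Suc (Suc j) mod Suc m" by (rule mod_Suc_eq)
      ultimately show "f (rotate1 ys ! j) (rotate1 ys ! (Suc j mod Suc m)) = H (Suc j mod Suc m)"
        using ne Suc by (simp add: nth_rotate1 H_def)
    qed simp
    also have "\<dots> = (\<Prod>j<m. H (Suc j)) * H 0" by simp
    also have "\<dots> = (\<Prod>j<Suc m. H j)" unfolding prod.lessThan_Suc_shift by (simp add: mult.commute)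
    finally show ?thesis unfolding cyclic_weight_def H_def Suc .
  qed simp
  then show ?case using Suc by simp
qed simp

lemma cyclic_weight_concat_replicate:
  "cyclic_weight f (concat (replicate r xs)) = cyclic_weight f xs ^ r"
proof (cases "xs = []")
  case True
  then show ?thesis by (simp add: cyclic_weight_def)
next
  case False
  define a where "a = length xs"
  have a: "0 < a" using False by (simp add: a_def)
  have "cyclic_weight f (concat (replicate r xs))
      = (\<Prod>j<r * a. f (xs ! (j mod a)) (xs ! (Suc j mod a)))"
    unfolding cyclic_weight_def length_concat_replicate a_def[symmetric]
  proof (rule prod.cong)
    fix j assume j: "j \<in> {..<r * a}"
    then have "Suc j mod (r * a) < r * a" by (intro mod_less_divisor) (metis lessThan_iff gr_zeroI not_less_zero)
    then show "f (concat (replicate r xs) ! j) (concat (replicate r xs) ! (Suc j mod (r * a)))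
      = f (xs ! (j mod a)) (xs ! (Suc j mod a))"
      using j by (simp add: nth_concat_replicate a_def mod_mod_cancel)
  qed simp
  \<comment> \<open>The r * a factors are cut into r blocks of length a, each of which is one full
    turn around \<open>xs\<close>.\<close>
  also have "\<dots> = (\<Prod>m<r. \<Prod>j = m * a..<m * a + a. f (xs ! (j mod a)) (xs ! (Suc j mod a)))"
    by (rule prod.nat_group[symmetric])
  also have "\<dots> = (\<Prod>m<r. cyclic_weight f xs)"
  proof (rule prod.cong)
    fix m
    have "(\<Prod>j = m * a..<m * a + a. f (xs ! (j mod a)) (xs ! (Suc j mod a)))
      = (\<Prod>j = 0..<a. f (xs ! ((j + m * a) mod a)) (xs ! (Suc (j + m * a) mod a)))"
      using prod.shift_bounds_nat_ivl[of "\<lambda>j. f (xs ! (j mod a)) (xs ! (Suc j mod a))" 0 "m * a" a]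
      unfolding add_0 add.commute[of a] .
    also have "\<dots> = cyclic_weight f xs"
      unfolding cyclic_weight_def a_def[symmetric] atLeast0LessThan
    proof (rule prod.cong)
      fix j assume "j \<in> {..<a}"
      moreover have "Suc (j + m * a) mod a = Suc j mod a"
        using mod_mult_self1[of "Suc j" m a] by simp
      ultimately show "f (xs ! ((j + m * a) mod a)) (xs ! (Suc (j + m * a) mod a))
        = f (xs ! j) (xs ! (Suc j mod a))" by simp
    qed simp
    finally show "(\<Prod>j = m * a..<m * a + a. f (xs ! (j mod a)) (xs ! (Suc j mod a)))
      = cyclic_weight f xs" .
  qed simp
  finally show ?thesis by simp
qed

subsection \<open>Prime roots of cycles\<close>

text \<open>With indices modulo the length, the closing condition is one more adjacency and
  \<open>j\<close> is unrestricted, so rotations and powers act by shifting and reducing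
  indices.\<close>

lemma is_cycle_iff_mod:
  "is_cycle G C \<longleftrightarrow> C \<noteq> [] \<and> set C \<subseteq> parcs G \<and>
    (\<forall>j. snd (C ! (j mod length C)) = fst (C ! (Suc j mod length C)))"
proof (cases "C = []")
  case False
  define n where "n = length C"
  have n: "0 < n" using False by (simp add: n_def)
  have *: "Suc (j mod n) mod n = Suc j mod n" for j by (rule mod_Suc_eq)
  have "(\<forall>j. snd (C ! (j mod n)) = fst (C ! (Suc j mod n))) \<longleftrightarrow>
    (\<forall>j<n. snd (C ! j) = fst (C ! (Suc j mod n)))"
    using n * by (metis mod_less mod_less_divisor)
  also have "\<dots> \<longleftrightarrow> (\<forall>j. Suc j < n \<longrightarrow> snd (C ! j) = fst (C ! Suc j)) \<and>
    snd (C ! (n - 1)) = fst (C ! 0)" (is "?L \<longleftrightarrow> ?R")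
  proof
    assume L: ?L
    show ?R
    proof (intro conjI allI impI)
      fix j assume "Suc j < n"
      then show "snd (C ! j) = fst (C ! Suc j)" using L[rule_format, of j] by simp
    next
      show "snd (C ! (n - 1)) = fst (C ! 0)" using L[rule_format, of "n - 1"] n by simp
    qed
  next
    assume R: ?R
    show ?L
    proof (intro allI impI)
      fix j assume "j < n"
      then consider "Suc j < n" | "Suc j = n" by linarith
      then show "snd (C ! j) = fst (C ! (Suc j mod n))"
        using R by cases auto
    qed
  qed
  finally show ?thesis
    using False by (simp add: is_cycle_def n_def last_conv_nth hd_conv_nth)
qed (simp add: is_cycle_def)

text \<open>One criterion for rotations, powers and roots: read cyclically, \<open>D\<close> runs
  through the same periodic sequence as \<open>C\<close>, started at position
  \<open>k\<close>.\<close>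

lemma cycle_of_periodic:
  assumes "is_cycle G C" "D \<noteq> []" "\<And>j. D ! (j mod length D) = C ! ((j + k) mod length C)"
  shows "is_cycle G D"
proof -
  have "C \<noteq> []" "set C \<subseteq> parcs G"
    and adj: "snd (C ! (j mod length C)) = fst (C ! (Suc j mod length C))" for j
    using assms(1) unfolding is_cycle_iff_mod by blast+
  have "set D \<subseteq> parcs G"
  proof
    fix x assume "x \<in> set D"
    then obtain j where "j < length D" "x = D ! j" by (auto simp: in_set_conv_nth)
    then have "x = C ! ((j + k) mod length C)" using assms(3)[of j] by simp
    then have "x \<in> set C" using \<open>C \<noteq> []\<close> by simp
    then show "x \<in> parcs G" using \<open>set C \<subseteq> parcs G\<close> by blast
  qed
  moreover have "snd (D ! (j mod length D)) = fst (D ! (Suc j mod length D))" for j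
    using adj[of "j + k"] assms(3)[of j] assms(3)[of "Suc j"] by simp
  ultimately show ?thesis using assms(2) unfolding is_cycle_iff_mod by blast
qed

lemma nth_rotate_mod:
  "C \<noteq> [] \<Longrightarrow> rotate k C ! (j mod length C) = C ! ((j + k) mod length C)"
  by (simp add: nth_rotate mod_add_right_eq add.commute)

lemma is_cycle_rotate:
  assumes "is_cycle G C"
  shows "is_cycle G (rotate k C)"
proof (rule cycle_of_periodic[OF assms])
  show "rotate k C \<noteq> []" using assms by (simp add: is_cycle_def)
  show "rotate k C ! (j mod length (rotate k C)) = C ! ((j + k) mod length C)" for j
    using assms nth_rotate_mod[of C k j] by (simp add: is_cycle_def)
qed

lemma is_cycle_concat_replicate:
  assumes "0 < r"
  shows "is_cycle G (concat (replicate r D)) \<longleftrightarrow> is_cycle G D"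
proof (cases "D = []")
  case True
  then show ?thesis by (simp add: is_cycle_def)
next
  case False
  let ?C = "concat (replicate r D)"
  have len: "length ?C = r * length D" by (rule length_concat_replicate)
  have ne: "?C \<noteq> []" using False assms len by (metis length_0_conv mult_is_0 neq0_conv)
  have nth: "?C ! (j mod length ?C) = D ! (j mod length D)" for j
  proof -
    have "j mod length ?C < r * length D" using ne len by (metis length_greater_0_conv mod_less_divisor)
    then show ?thesis by (subst nth_concat_replicate) (simp_all add: len mod_mod_cancel)
  qed
  show ?thesis
  proof
    assume "is_cycle G ?C"
    then show "is_cycle G D" using False nth by (intro cycle_of_periodic[of G ?C D 0]) simp_all
  next
    assume "is_cycle G D"
    then show "is_cycle G ?C" using ne nth by (intro cycle_of_periodic[of G D ?C 0]) simp_all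
  qed
qed

text \<open>By Bezout, invariance under shifts by |D| and k gives invariance under g = gcd(|D|, k).
  As g divides |D|, the cycle is a power of its prefix of length g, and primality forces g =
  |D|.\<close>

lemma prime_cycle_period:
  assumes "prime_cycle G D" "\<And>i. D ! ((i + k) mod length D) = D ! (i mod length D)"
  shows "length D dvd k"
proof -
  let ?a = "length D"
  define g where "g = gcd ?a k"
  have D: "is_cycle G D" and ne: "D \<noteq> []" using assms(1) by (auto simp: prime_cycle_def is_cycle_def)
  have mult: "D ! ((i + k * y) mod ?a) = D ! (i mod ?a)" for i y
  proof (induction y)
    case (Suc y)
    then show ?case using assms(2)[of "i + k * y"] by (simp add: ac_simps)
  qed simp
  \<comment> \<open>Bezout without subtraction: a shift by \<open>g + k * y\<close> makes
    \<open>x\<close> full turns, while its part \<open>k * y\<close> has no effect by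
    \<open>mult\<close>.\<close>
  obtain x y where xy: "?a * x = k * y + g"
    using bezout_nat[of ?a k] ne by (auto simp: g_def)
  have per: "D ! ((i + g) mod ?a) = D ! (i mod ?a)" for i
  proof -
    have "D ! ((i + g) mod ?a) = D ! ((i + g + k * y) mod ?a)" by (rule mult[symmetric])
    also have "i + g + k * y = i + ?a * x" using xy by simp
    finally show ?thesis by simp
  qed
  have per': "D ! ((i + g * y) mod ?a) = D ! (i mod ?a)" for i y
  proof (induction y)
    case (Suc y)
    then show ?case using per[of "i + g * y"] by (simp add: ac_simps)
  qed simp
  have g: "0 < g" "g dvd ?a" using ne by (auto simp: g_def)
  have "D = concat (replicate (?a div g) (take g D))"
  proof (rule eq_concat_replicate_take[OF g])
    fix i assume "i < ?a"
    moreover have "i mod g < ?a"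
      using g ne by (meson dvd_imp_le length_greater_0_conv less_le_trans mod_less_divisor)
    ultimately show "D ! i = D ! (i mod g)"
      using per'[of "i mod g" "i div g"] by simp
  qed
  \<comment> \<open>Primality excludes only roots that are themselves cycles, so the prefix has to
    be shown to be one.\<close>
  moreover from this have "is_cycle G (take g D)"
    using D g ne is_cycle_concat_replicate[of "?a div g" G "take g D"]
    by (simp add: dvd_imp_le div_greater_zero_iff)
  ultimately have "\<not> 2 \<le> ?a div g" using assms(1) unfolding prime_cycle_def by metis
  moreover have "?a div g \<noteq> 0" using g ne by (simp add: dvd_imp_le div_eq_0_iff not_less)
  ultimately have "?a div g = 1" by linarith
  then have "?a = g" using g by (metis dvd_div_mult_self mult_1)
  then show ?thesis unfolding g_def by (metis gcd_dvd2)
qed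

text \<open>The common power, read cyclically, repeats both \<open>D\<close> and \<open>E\<close>.
  Hence shifting by |E| leaves the cyclic reading of \<open>D\<close> unchanged, and the period
  lemma applies.\<close>

lemma prime_root_length_dvd:
  assumes "prime_cycle G D" "E \<noteq> []" "concat (replicate r D) = concat (replicate s E)" "0 < r" "0 < s"
  shows "length D dvd length E"
proof (rule prime_cycle_period[OF assms(1)])
  fix i
  let ?C = "concat (replicate r D)"
  let ?n = "length ?C"
  have D: "D \<noteq> []" using assms(1) by (auto simp: prime_cycle_def is_cycle_def)
  have n: "?n = r * length D" "?n = s * length E"
    using length_concat_replicate[of r D] length_concat_replicate[of s E] assms(3) by simp_all
  have pos: "0 < ?n" unfolding n(1) using D assms(4) by simp
  have lt: "j mod ?n < ?n" for j using pos by (rule mod_less_divisor)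
  have nD: "?C ! (j mod ?n) = D ! (j mod length D)" for j
    using nth_concat_replicate[of "j mod ?n" r D] lt[of j] n(1) by (simp add: mod_mod_cancel)
  have nE: "?C ! (j mod ?n) = E ! (j mod length E)" for j
    using nth_concat_replicate[of "j mod ?n" s E] lt[of j] n(2) assms(3) by (simp add: mod_mod_cancel)
  show "D ! ((i + length E) mod length D) = D ! (i mod length D)"
    unfolding nD[symmetric] nE by simp
qed

text \<open>Divisibility in both directions makes the lengths equal; then the first blocks of the
  two powers coincide.\<close>

lemma prime_root_unique:
  assumes "prime_cycle G D" "prime_cycle G E"
    "concat (replicate r D) = concat (replicate s E)" "0 < r" "0 < s"
  shows "D = E"
proof -
  have ne: "D \<noteq> []" "E \<noteq> []" using assms(1,2) by (auto simp: prime_cycle_def is_cycle_def)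
  have "length D = length E"
    using prime_root_length_dvd[OF assms(1) ne(2) assms(3-5)]
      prime_root_length_dvd[OF assms(2) ne(1) assms(3)[symmetric] assms(5,4)] by (rule dvd_antisym)
  moreover obtain r' s' where "r = Suc r'" "s = Suc s'" using assms(4,5) gr0_implies_Suc by metis
  ultimately show ?thesis using assms(3) by simp
qed

text \<open>Descent on the length: a cycle that is not prime is a power of a shorter cycle, and
  exponents multiply along the descent.\<close>

lemma prime_root_exists:
  assumes "is_cycle G C"
  shows "\<exists>D r. prime_cycle G D \<and> 0 < r \<and> C = concat (replicate r D)"
  using assms
proof (induction "length C" arbitrary: C rule: less_induct)
  case less
  show ?case
  proof (cases "prime_cycle G C")
    case True
    then show ?thesis by (intro exI[of _ C] exI[of _ 1]) simp
  next
    case False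
    then obtain D r where D: "is_cycle G D" "2 \<le> r" "C = concat (replicate r D)"
      using less.prems by (auto simp: prime_cycle_def)
    then have "length D < length C"
      by (simp add: length_concat_replicate is_cycle_def)
    from less.hyps[OF this D(1)] obtain E s where E: "prime_cycle G E" "0 < s" "D = concat (replicate s E)"
      by blast
    have "concat (replicate r (concat (replicate s E))) = concat (replicate (r * s) E)"
      by (induction r) (auto simp: replicate_add)
    then show ?thesis using D E by (intro exI[of _ E] exI[of _ "r * s"]) auto
  qed
qed

text \<open>If a rotation of \<open>C\<close> were an r-th power of \<open>D\<close> with r \<ge> 2,
  then |D| would be a period of \<open>C\<close>, so |C| = r |D| would divide |D|.\<close>

lemma prime_cycle_rotate:
  assumes "prime_cycle G C"
  shows "prime_cycle G (rotate k C)"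
  unfolding prime_cycle_def
proof (intro conjI notI)
  have C: "is_cycle G C" using assms by (simp add: prime_cycle_def)
  then show "is_cycle G (rotate k C)" by (rule is_cycle_rotate)
  have ne: "C \<noteq> []" using C by (simp add: is_cycle_def)
  assume "\<exists>D r. is_cycle G D \<and> 2 \<le> r \<and> rotate k C = concat (replicate r D)"
  then obtain D r where D: "is_cycle G D" "2 \<le> r" "rotate k C = concat (replicate r D)" by blast
  have len: "length C = r * length D"
    using D(3) by (metis length_concat_replicate length_rotate)
  have dpos: "0 < length D" using D(1) by (simp add: is_cycle_def)
  have rot: "rotate k C ! (j mod length C) = D ! (j mod length D)" for j
  proof -
    have "j mod length C < r * length D" using len ne by (metis length_greater_0_conv mod_less_divisor)
    then show ?thesis unfolding D(3) by (subst nth_concat_replicate) (simp_all add: len mod_mod_cancel)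
  qed
  have "length C dvd length D"
  proof (rule prime_cycle_period[OF assms])
    fix i
    \<comment> \<open>\<open>i'\<close> is \<open>i\<close> moved back by \<open>k\<close> modulo
      the length; adding \<open>k * length C\<close> first keeps the natural subtraction from
      truncating.\<close>
    define i' where "i' = i + k * length C - k"
    have kk: "k \<le> k * length C" using ne by (cases C) auto
    have i: "(i' + k) mod length C = i mod length C" 
    proof -
      have "i' + k = i + k * length C" using kk unfolding i'_def by linarith
      then show ?thesis by simp
    qed
    have i2: "(i' + length D + k) mod length C = (i + length D) mod length C"
    proof -
      have "i' + length D + k = i + length D + k * length C" using kk unfolding i'_def by linarith
      then show ?thesis by (simp only: mod_mult_self1)
    qed
    have "C ! ((i + length D) mod length C) = rotate k C ! ((i' + length D) mod length C)"
      using nth_rotate_mod[OF ne, of k "i' + length D"] i2 by simp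
    also have "\<dots> = rotate k C ! (i' mod length C)" unfolding rot by simp
    also have "\<dots> = C ! (i mod length C)" using nth_rotate_mod[OF ne, of k i'] i by simp
    finally show "C ! ((i + length D) mod length C) = C ! (i mod length C)" .
  qed
  then have "r * length D \<le> length D" using len dpos by (simp add: dvd_imp_le)
  then show False using D(2) dpos by simp
qed

text \<open>Equal rotations by k \<le> l make l - k a period of a prime cycle; being smaller than
  the length, it is 0. So a prime cycle has as many distinct rotations as its length.\<close>

lemma prime_cycle_rotate_inj:
  assumes "prime_cycle G C" "rotate k C = rotate l C" "k < length C" "l < length C"
  shows "k = l"
proof -
  have *: "k = l" if "rotate k C = rotate l C" "k \<le> l" "l < length C" for k l
  proof -
    have ne: "C \<noteq> []" using that(3) by auto
    have "length (rotate k C) dvd l - k"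
    proof (rule prime_cycle_period[OF prime_cycle_rotate[OF assms(1)]])
      fix i
      have "rotate k C ! ((i + (l - k)) mod length C) = C ! ((i + l) mod length C)"
        using nth_rotate_mod[OF ne, of k "i + (l - k)"] \<open>k \<le> l\<close> by simp
      also have "\<dots> = rotate k C ! (i mod length C)"
        using nth_rotate_mod[OF ne, of l i] that(1) by simp
      finally show "rotate k C ! ((i + (l - k)) mod length (rotate k C))
        = rotate k C ! (i mod length (rotate k C))" by simp
    qed
    then have "l - k = 0" using that(3) by (auto dest: dvd_imp_le)
    with that(2) show ?thesis by simp
  qed
  show ?thesis using *[of k l] *[of l k] assms(2-4) by (cases "k \<le> l") auto
qed

subsection \<open>The product over classes of prime cycles\<close>

lemma equiv_cycle_equiv: "equiv {C. is_cycle G C} (cycle_equiv G)"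
proof (rule equivI)
  show "cycle_equiv G \<subseteq> {C. is_cycle G C} \<times> {C. is_cycle G C}"
    by (auto simp: cycle_equiv_def)
  show "refl_on {C. is_cycle G C} (cycle_equiv G)"
    by (auto simp: refl_on_def cycle_equiv_def intro!: exI[of _ 0])
  show "sym (cycle_equiv G)"
  proof (rule symI)
    fix C D assume "(C, D) \<in> cycle_equiv G"
    then obtain k where CD: "is_cycle G C" "is_cycle G D" "D = rotate k C"
      by (auto simp: cycle_equiv_def)
    \<comment> \<open>The inverse rotation completes \<open>k\<close> to \<open>k\<close> full
      turns; the difference does not truncate because \<open>C\<close> is nonempty.\<close>
    have "rotate (k * length C - k) D = rotate (k * length C) C"
      using CD by (cases C) (simp_all add: rotate_rotate is_cycle_def add.commute)
    also have "\<dots> = C" by (simp add: rotate_id)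
    finally have "\<exists>j. C = rotate j D" by metis
    then show "(D, C) \<in> cycle_equiv G" using CD(1,2) by (simp add: cycle_equiv_def)
  qed
  show "trans (cycle_equiv G)"
    by (rule transI) (auto simp: cycle_equiv_def rotate_rotate)
qed

lemma prime_class_member:
  assumes "c \<in> prime_cycle_classes G" "D \<in> c"
  shows "prime_cycle G D" "c = cycle_equiv G `` {D}"
proof -
  obtain C where C: "prime_cycle G C" "c = cycle_equiv G `` {C}"
    using assms(1) by (auto simp: prime_cycle_classes_def elim: quotientE)
  then have CD: "(C, D) \<in> cycle_equiv G" using assms(2) by simp
  then show "prime_cycle G D" using C(1) by (auto simp: cycle_equiv_def intro: prime_cycle_rotate)
  show "c = cycle_equiv G `` {D}"
    unfolding C(2) by (rule equiv_class_eq[OF equiv_cycle_equiv CD])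
qed

section \<open>Counting cycles by prime classes, for an arbitrary choice of representatives\<close>

context
  fixes G :: "'v pair_pre_digraph" and rep :: "('v \<times> 'v) list set \<Rightarrow> ('v \<times> 'v) list"
  assumes fin: "finite (parcs G)"
    and rep: "\<And>c. c \<in> prime_cycle_classes G \<Longrightarrow> rep c \<in> c"
begin

lemma prime_cycle_rep: "c \<in> prime_cycle_classes G \<Longrightarrow> prime_cycle G (rep c)"
  using prime_class_member(1) rep by blast

lemma is_cycle_rep: "c \<in> prime_cycle_classes G \<Longrightarrow> is_cycle G (rep c)"
  using prime_cycle_rep by (simp add: prime_cycle_def)

lemma length_rep_pos: "c \<in> prime_cycle_classes G \<Longrightarrow> 0 < length (rep c)"
  using is_cycle_rep by (simp add: is_cycle_def)

text \<open>A class is recovered from its representative, and there are only finitely many words of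
  bounded length over the finite set of arcs.\<close>

lemma finite_short_classes: "finite {c \<in> prime_cycle_classes G. length (rep c) \<le> n}"
proof (rule inj_on_finite)
  show "inj_on rep {c \<in> prime_cycle_classes G. length (rep c) \<le> n}"
    by (rule inj_on_inverseI[where g = "\<lambda>C. cycle_equiv G `` {C}"])
      (use prime_class_member(2) rep in fastforce)
  show "rep ` {c \<in> prime_cycle_classes G. length (rep c) \<le> n}
    \<subseteq> {xs. set xs \<subseteq> parcs G \<and> length xs \<le> n}"
    using is_cycle_rep by (auto simp: is_cycle_def)
  show "finite {xs. set xs \<subseteq> parcs G \<and> length xs \<le> n}"
    using fin by (rule finite_lists_length_le)
qed

text \<open>Every cycle is a power of a unique prime root: \<open>c\<close> is the class of the
  root, \<open>k\<close> selects the rotation of the representative, and the exponent is forced by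
  the length \<open>n\<close>.\<close>

lemma cycles_bij:
  assumes "0 < n"
  shows "bij_betw (\<lambda>(c, k). concat (replicate (n div length (rep c)) (rotate k (rep c))))
    (SIGMA c:{c \<in> prime_cycle_classes G. length (rep c) dvd n}. {..<length (rep c)})
    {C. is_cycle G C \<and> length C = n}"
    (is "bij_betw ?\<phi> ?T ?C")
proof (rule bij_betw_imageI)
  have pos: "0 < n div length (rep c)" if "c \<in> prime_cycle_classes G" "length (rep c) dvd n" for c
    using that assms length_rep_pos by (simp add: dvd_imp_le div_greater_zero_iff)
  show "inj_on ?\<phi> ?T"
  proof (rule inj_onI)
    fix p q assume pq: "p \<in> ?T" "q \<in> ?T" "?\<phi> p = ?\<phi> q"
    obtain c k c' k' where p: "p = (c, k)" and q: "q = (c', k')" by (cases p, cases q)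
    have c: "c \<in> prime_cycle_classes G" "length (rep c) dvd n" "k < length (rep c)"
      and c': "c' \<in> prime_cycle_classes G" "length (rep c') dvd n" "k' < length (rep c')"
      using pq(1,2) by (auto simp: p q)
    \<comment> \<open>Both rotations are prime roots of the same cycle.\<close>
    have eq: "rotate k (rep c) = rotate k' (rep c')"
    proof (rule prime_root_unique)
      show "concat (replicate (n div length (rep c)) (rotate k (rep c)))
        = concat (replicate (n div length (rep c')) (rotate k' (rep c')))"
        using pq(3) by (simp add: p q)
    qed (use c c' pos prime_cycle_rep in \<open>auto intro: prime_cycle_rotate\<close>)
    have mem: "rotate j (rep b) \<in> b" if "b \<in> prime_cycle_classes G" for b j
      using prime_class_member(2)[OF that rep[OF that]] is_cycle_rep[OF that]
      by (metis (mono_tags, lifting) Image_singleton_iff case_prodI cycle_equiv_def is_cycle_rotate mem_Collect_eq)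
    have "c = c'"
      using prime_class_member(2)[OF c(1) mem[OF c(1), of k]]
        prime_class_member(2)[OF c'(1) mem[OF c'(1), of k']] eq by simp
    moreover from this have "k = k'"
      using prime_cycle_rotate_inj[OF prime_cycle_rep[OF c(1)]] eq c c' by simp
    ultimately show "p = q" by (simp add: p q)
  qed
  show "?\<phi> ` ?T = ?C"
  proof (intro equalityI subsetI)
    fix C assume "C \<in> ?\<phi> ` ?T"
    then obtain c k where c: "c \<in> prime_cycle_classes G" "length (rep c) dvd n"
      and C: "C = concat (replicate (n div length (rep c)) (rotate k (rep c)))" by auto
    have "is_cycle G C"
      unfolding C is_cycle_concat_replicate[OF pos[OF c]] using is_cycle_rep[OF c(1)] by (rule is_cycle_rotate)
    moreover have "length C = n" unfolding C length_concat_replicate using c(2) by simp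
    ultimately show "C \<in> ?C" by simp
  next
    fix C assume C: "C \<in> ?C"
    then obtain D r where D: "prime_cycle G D" "0 < r" "C = concat (replicate r D)"
      using prime_root_exists by blast
    define c where "c = cycle_equiv G `` {D}"
    have c: "c \<in> prime_cycle_classes G"
      unfolding c_def prime_cycle_classes_def using D(1) by (intro quotientI) simp
    have "(D, rep c) \<in> cycle_equiv G" using rep[OF c] by (simp add: c_def)
    then have "(rep c, D) \<in> cycle_equiv G"
      using equiv_cycle_equiv by (meson equivE symD)
    then obtain k where k: "D = rotate k (rep c)" by (auto simp: cycle_equiv_def)
    have n: "n = r * length (rep c)" using C D(3) k by (metis (mono_tags, lifting) length_concat_replicate length_rotate mem_Collect_eq)
    \<comment> \<open>The equivalence supplies an arbitrary \<open>k\<close>; it is reduced to the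
      range of the index set.\<close>
    have "C = ?\<phi> (c, k mod length (rep c))"
      using D(3) k n length_rep_pos[OF c] by (simp add: rotate_conv_mod[symmetric])
    moreover have "(c, k mod length (rep c)) \<in> ?T"
      using c n length_rep_pos[OF c] by simp
    ultimately show "C \<in> ?\<phi> ` ?T" by blast
  qed
qed

text \<open>Words that are not cycles contribute 0. Cycles are grouped by their prime roots; the
  weight does not depend on the rotation, so summing over rotations produces the factor |C|.\<close>

lemma cyclic_sum_eq_prime_sum:
  assumes "0 < n" and zero: "\<And>e f. e \<in> parcs G \<Longrightarrow> snd e \<noteq> fst f \<Longrightarrow> w e f = 0"
  shows "(\<Sum>xs | set xs \<subseteq> parcs G \<and> length xs = n. cyclic_weight w xs)
    = (\<Sum>c | c \<in> prime_cycle_classes G \<and> length (rep c) dvd n.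
        of_nat (length (rep c)) * cyclic_weight w (rep c) ^ (n div length (rep c)))"
proof -
  let ?I = "{c \<in> prime_cycle_classes G. length (rep c) dvd n}"
  have "(\<Sum>xs | set xs \<subseteq> parcs G \<and> length xs = n. cyclic_weight w xs)
    = (\<Sum>xs | is_cycle G xs \<and> length xs = n. cyclic_weight w xs)"
  proof (rule sum.mono_neutral_right)
    show "finite {xs. set xs \<subseteq> parcs G \<and> length xs = n}"
      using fin by (rule finite_lists_length_eq)
    show "{xs. is_cycle G xs \<and> length xs = n} \<subseteq> {xs. set xs \<subseteq> parcs G \<and> length xs = n}"
      by (auto simp: is_cycle_def)
    show "\<forall>xs\<in>{xs. set xs \<subseteq> parcs G \<and> length xs = n} - {xs. is_cycle G xs \<and> length xs = n}.
      cyclic_weight w xs = 0"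
    proof
      fix xs assume xs: "xs \<in> {xs. set xs \<subseteq> parcs G \<and> length xs = n} - {xs. is_cycle G xs \<and> length xs = n}"
      then have ne: "xs \<noteq> []" using assms(1) by auto
      \<comment> \<open>A word that is not a cycle fails some cyclic adjacency, and the factor of
        its weight at that place is 0.\<close>
      with xs obtain j where "snd (xs ! (j mod n)) \<noteq> fst (xs ! (Suc j mod n))"
        by (auto simp: is_cycle_iff_mod)
      moreover have "Suc (j mod n) mod n = Suc j mod n" by (rule mod_Suc_eq)
      moreover have "j mod n < n" using assms(1) by simp
      moreover from this have "xs ! (j mod n) \<in> parcs G" using xs nth_mem by blast
      ultimately have "\<exists>j\<in>{..<length xs}. w (xs ! j) (xs ! (Suc j mod length xs)) = 0"
        using zero xs by (intro bexI[of _ "j mod n"]) auto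
      then show "cyclic_weight w xs = 0" unfolding cyclic_weight_def by (simp add: prod_zero_iff)
    qed
  qed
  also have "\<dots> = (\<Sum>(c, k)\<in>(SIGMA c:?I. {..<length (rep c)}).
      cyclic_weight w (rep c) ^ (n div length (rep c)))"
    by (subst sum.reindex_bij_betw[OF cycles_bij[OF assms(1)], symmetric])
      (simp add: case_prod_unfold cyclic_weight_concat_replicate cyclic_weight_rotate)
  also have "\<dots> = (\<Sum>c\<in>?I. \<Sum>k<length (rep c). cyclic_weight w (rep c) ^ (n div length (rep c)))"
  proof (rule sum.Sigma[symmetric])
    show "finite ?I"
      by (rule finite_subset[OF _ finite_short_classes[of n]]) (use assms(1) in \<open>auto dest: dvd_imp_le\<close>)
  qed simp
  finally show ?thesis by simp
qed

lemma det_eq_prime_cycle_product: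
  assumes es: "distinct es" "set es = parcs G"
    and zero: "\<And>e f. e \<in> parcs G \<Longrightarrow> snd e \<noteq> fst f \<Longrightarrow> w e f = 0"
    and A: "A = mat (length es) (length es) (\<lambda>(i, j). w (es ! i) (es ! j))"
  shows "has_product_over (\<lambda>c. 1 - fps_const (cyclic_weight w (rep c)) * fps_X ^ length (rep c))
    (prime_cycle_classes G) (Determinant.det (1\<^sub>m (length es) - fps_X \<cdot>\<^sub>m map_mat fps_const A))"
  unfolding has_product_over_def
proof (rule tendsto_fpsI)
  fix n
  let ?N = "length es"
  let ?D = "Determinant.det (1\<^sub>m ?N - fps_X \<cdot>\<^sub>m map_mat fps_const A)"
  let ?f = "\<lambda>c. 1 - fps_const (cyclic_weight w (rep c)) * fps_X ^ length (rep c)"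
  have "A \<in> carrier_mat ?N ?N" by (simp add: A)
  then obtain ev where ev: "?D = (\<Prod>i<?N. 1 - fps_const (ev i) * fps_X)"
    "\<And>k. (\<Sum>i<?N. (A ^\<^sub>m k) $$ (i, i)) = (\<Sum>i<?N. ev i ^ k)"
    using eigenvalue_expansion by blast
  \<comment> \<open>The partial products have constant n-th coefficient once all classes of length
    at most \<open>n\<close> are included, which is the convergence to be shown.\<close>
  have coeff: "fps_nth (prod ?f F) n = fps_nth ?D n"
    if F: "finite F" "{c \<in> prime_cycle_classes G. length (rep c) \<le> n} \<subseteq> F"
      "F \<subseteq> prime_cycle_classes G" for F
  proof (rule fps_nth_eq_of_log_deriv_eq)
    have pos: "0 < length (rep c)" if "c \<in> F" for c using that F(3) length_rep_pos by blast
    let ?S = "\<Sum>c\<in>F. power_sum_fps (cyclic_weight w (rep c)) (length (rep c))"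
    \<comment> \<open>With l = 1 the k-th coefficient for k > 0 is \<open>ev i ^ k\<close>, so the
      coefficients of \<open>?T\<close> are the traces of the powers of \<open>A\<close>.\<close>
    let ?T = "\<Sum>i<?N. power_sum_fps (ev i) 1"
    show "fps_X * fps_deriv (prod ?f F) = - prod ?f F * ?S"
      using F(1) pos by (rule X_deriv_prod)
    show "fps_X * fps_deriv ?D = - ?D * ?T"
      using X_deriv_prod[of "{..<?N}" "\<lambda>_. 1" ev] by (simp add: ev(1))
    have "fps_nth (prod ?f F) 0 = (\<Prod>c\<in>F. fps_nth (?f c) 0)"
      by (simp add: fps_prod_nth0)
    also have "\<dots> = 1" using pos by (intro prod.neutral) auto
    finally show "fps_nth (prod ?f F) 0 = fps_nth ?D 0"
      by (simp add: ev(1) fps_prod_nth0)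
    show "fps_nth ?S 0 = 0" by (simp add: fps_sum_nth power_sum_fps_def)
    show "fps_nth ?S k = fps_nth ?T k" if "k \<le> n" for k
    proof (cases "k = 0")
      case False
      then have k: "0 < k" by simp
      have "fps_nth ?S k = (\<Sum>c\<in>F. if length (rep c) dvd k
          then of_nat (length (rep c)) * cyclic_weight w (rep c) ^ (k div length (rep c)) else 0)"
        using k by (simp add: fps_sum_nth power_sum_fps_def)
      also have "\<dots> = (\<Sum>c\<in>{c \<in> F. length (rep c) dvd k}.
          of_nat (length (rep c)) * cyclic_weight w (rep c) ^ (k div length (rep c)))"
        using F(1) by (simp add: sum.inter_filter)
      \<comment> \<open>A length dividing k > 0 is at most n, so no contributing class is missing
        from \<open>F\<close>; longer classes in \<open>F\<close> have no effect.\<close>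
      also have "{c \<in> F. length (rep c) dvd k}
          = {c. c \<in> prime_cycle_classes G \<and> length (rep c) dvd k}"
      proof -
        have "length (rep c) \<le> n" if "length (rep c) dvd k" for c
          using dvd_imp_le[OF that k] \<open>k \<le> n\<close> by simp
        then show ?thesis using F(2,3) by blast
      qed
      also have "(\<Sum>c\<in>\<dots>. of_nat (length (rep c)) * cyclic_weight w (rep c) ^ (k div length (rep c)))
          = (\<Sum>xs | set xs \<subseteq> parcs G \<and> length xs = k. cyclic_weight w xs)"
        using k zero by (rule cyclic_sum_eq_prime_sum[symmetric])
      also have "\<dots> = (\<Sum>i<?N. (A ^\<^sub>m k) $$ (i, i))"
        using trace_pow_eq_cyclic_sum[OF es(1) A k] es(2) by simp
      also have "\<dots> = fps_nth ?T k"
        using k by (simp add: ev(2) fps_sum_nth power_sum_fps_def)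
      finally show ?thesis .
    qed (simp add: fps_sum_nth power_sum_fps_def)
  qed
  show "\<forall>\<^sub>F F in finite_subsets_at_top (prime_cycle_classes G). fps_nth (prod ?f F) n = fps_nth ?D n"
    unfolding eventually_finite_subsets_at_top
    using finite_short_classes[of n] coeff
    by (intro exI[of _ "{c \<in> prime_cycle_classes G. length (rep c) \<le> n}"]) auto
qed

end

theorem theorem5:
  fixes G :: "'v pair_pre_digraph"
    and d :: "'v \<Rightarrow> real"
    and h \<gamma> :: "'v \<times> 'v \<Rightarrow> real"
    and lam :: complex
    and m :: nat
    and es :: "('v \<times> 'v) list"
    and rep :: "('v \<times> 'v) list set \<Rightarrow> ('v \<times> 'v) list"
  assumes graph: "pair_graph G"
    and conn: "Digraph_Component.connected (with_proj G)"
    and edges: "m = card (edge_set G)"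
    and h_nonneg: "\<And>f. f \<in> parcs G \<Longrightarrow> 0 \<le> h f"
    and gamma_range: "\<And>f. f \<in> parcs G \<Longrightarrow> \<gamma> f \<in> {- pi / 2 .. pi / 2}"
    and h_sym: "\<And>f. f \<in> parcs G \<Longrightarrow> h (prod.swap f) = h f"
    and gamma_antisym: "\<And>f. f \<in> parcs G \<Longrightarrow> \<gamma> (prod.swap f) = - \<gamma> f"
    and lambda_ok: "\<And>u. u \<in> pverts G \<Longrightarrow>
      herm_entry G d h \<gamma> u u - lam - \<i> * complex_of_real (arc_weight_sum G h u) \<noteq> 0"
    and enum: "distinct es" "set es = parcs G"
    and rep: "\<And>c. c \<in> prime_cycle_classes G \<Longrightarrow> rep c \<in> c"
  shows "has_product_over
    (\<lambda>c. 1 - fps_const (cycle_weight G d h \<gamma> lam (rep c)) * fps_X ^ length (rep c))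
    (prime_cycle_classes G)
    (Determinant.det (1\<^sub>m (2 * m)
       - fps_X \<cdot>\<^sub>m map_mat fps_const (bond_scattering_mat G d h \<gamma> lam es)))"
proof -
  let ?w = "bond_entry G d h \<gamma> lam"
  have fin: "finite (parcs G)" using enum(2) by (metis finite_set)
  have N: "2 * m = length es"
    using card_parcs_edge_set[OF graph] enum edges distinct_card by metis
  \<comment> \<open>Along a cycle the adjacency test in \<open>bond_entry\<close> always succeeds,
    which leaves exactly the factors \<open>scat\<close> of \<open>cycle_weight\<close>.\<close>
  have weight: "cycle_weight G d h \<gamma> lam (rep c) = cyclic_weight ?w (rep c)"
    if "c \<in> prime_cycle_classes G" for c
  proof -
    have "is_cycle G (rep c)" using fin rep that by (rule is_cycle_rep)
    then have "snd (rep c ! (j mod length (rep c))) = fst (rep c ! (Suc j mod length (rep c)))" for j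
      unfolding is_cycle_iff_mod by blast
    from this[of j for j] show ?thesis
      unfolding cycle_weight_def cyclic_weight_def
      by (intro prod.cong refl) (metis bond_entry_def lessThan_iff mod_less)
  qed
  have "has_product_over (\<lambda>c. 1 - fps_const (cyclic_weight ?w (rep c)) * fps_X ^ length (rep c))
    (prime_cycle_classes G) (Determinant.det (1\<^sub>m (2 * m)
       - fps_X \<cdot>\<^sub>m map_mat fps_const (bond_scattering_mat G d h \<gamma> lam es)))"
    unfolding N using fin rep enum
    by (rule det_eq_prime_cycle_product) (simp_all add: bond_entry_def bond_scattering_mat_def)
  \<comment> \<open>The two weights are compared only at representatives of prime classes, which
    suffices because the partial products run over finite subsets of
    \<open>prime_cycle_classes G\<close>.\<close>
  moreover have "\<forall>\<^sub>F F in finite_subsets_at_top (prime_cycle_classes G).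
    (\<Prod>c\<in>F. 1 - fps_const (cyclic_weight ?w (rep c)) * fps_X ^ length (rep c))
    = (\<Prod>c\<in>F. 1 - fps_const (cycle_weight G d h \<gamma> lam (rep c)) * fps_X ^ length (rep c))"
    by (rule eventually_finite_subsets_at_top_weakI) (auto simp: weight intro!: prod.cong)
  ultimately show ?thesis
    unfolding has_product_over_def by (rule Lim_transform_eventually)
qed

end
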